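(* There exist universal constants $C,c>0$ such that the following holds. Let $k\le 2m$ be an even positive integer, and let $\Gamma=\{\gamma_t\}_{t=1}^k\subseteq\mathbb R^m$ denote the standard orthoplex of dimension $k/2$. Then for every $\sigma>0$, either $$\sigma\le C\,\frac{\Delta_{\min}}{\sqrt{\log k}}\qquad\text{or}\qquad \min_{t\in\{1,\dots,k\}}\big\|\mu_t^{(\Gamma,\mathcal D)}-\gamma_t\big\|_2\ge c\,\sigma\sqrt{\log k},$$ where $\mathcal D$ denotes the mixture of equally weighted spherical Gaussians of entrywise variance $\sigma^2$ centered at the members of $\Gamma$.
   Context: The standard orthoplex of dimension $d$ in $\mathbb R^m$ ($d\le m$) is the set of $2d$ points given by the first $d$ columns of the $m\times m$ identity matrix $I$ and the first $d$ columns of $-I$. $\Delta_{\min}=\min_{a\neq b}\|\gamma_a-\gamma_b\|_2$. For $\Gamma=\{\gamma_t\}_{t=1}^k$, the Voronoi cell of $\gamma_a$ is $V_a^{(\Gamma)}=\{x\in\mathbb R^m:\|x-\gamma_a\|_2<\|x-\gamma_b\|_2\ \forall b\ne a\}$, and for a probability distribution $\mathcal D$ on $\mathbb R^m$ the Voronoi means are $\mu_t^{(\Gamma,\mathcal D)}=\mathbb E_{X\sim\mathcal D}[X\mid X\in V_t^{(\Gamma)}]$. The mixture $\mathcal D$ is $\frac1k\sum_{t=1}^k\mathcal N(\gamma_t,\sigma^2I_m)$. *)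

theory Defs
  imports "HOL-Probability.Probability"
begin

text \<open>
  The constants of the theorem are uniform in the dimension \<open>m\<close>, so \<open>m\<close> has to be quantified inside
  the statement and cannot be a type. A point of \<open>\<real>\<^sup>m\<close> is therefore a function in
  \<open>{..<m} \<rightarrow>\<^sub>E UNIV\<close>, the space of the product measure \<open>\<Pi>\<^sub>M i\<in>{..<m}. lborel\<close>.
\<close>

definition vdist :: "nat \<Rightarrow> (nat \<Rightarrow> real) \<Rightarrow> (nat \<Rightarrow> real) \<Rightarrow> real" where
  "vdist m x y = L2_set (\<lambda>i. x i - y i) {..<m}"

definition id_column :: "nat \<Rightarrow> nat \<Rightarrow> nat \<Rightarrow> real" where
  "id_column m j = (\<lambda>i\<in>{..<m}. if i = j then 1 else 0)"

definition standard_orthoplex :: "nat \<Rightarrow> nat \<Rightarrow> (nat \<Rightarrow> real) set" where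
  "standard_orthoplex m d =
     id_column m ` {..<d} \<union> (\<lambda>j. \<lambda>i\<in>{..<m}. - id_column m j i) ` {..<d}"

definition min_separation :: "nat \<Rightarrow> nat \<Rightarrow> (nat \<Rightarrow> nat \<Rightarrow> real) \<Rightarrow> real" where
  "min_separation m k \<gamma> = Min {vdist m (\<gamma> a) (\<gamma> b) | a b. a \<in> {1..k} \<and> b \<in> {1..k} \<and> a \<noteq> b}"

definition voronoi_cell :: "nat \<Rightarrow> nat \<Rightarrow> (nat \<Rightarrow> nat \<Rightarrow> real) \<Rightarrow> nat \<Rightarrow> (nat \<Rightarrow> real) set" where
  "voronoi_cell m k \<gamma> a =
     {x \<in> {..<m} \<rightarrow>\<^sub>E UNIV. \<forall>b\<in>{1..k}. b \<noteq> a \<longrightarrow> vdist m x (\<gamma> a) < vdist m x (\<gamma> b)}"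

text \<open>\<open>normal_density\<close> takes the standard deviation, so each coordinate has variance \<open>\<sigma>\<^sup>2\<close>.\<close>

definition spherical_gaussian :: "nat \<Rightarrow> (nat \<Rightarrow> real) \<Rightarrow> real \<Rightarrow> (nat \<Rightarrow> real) measure" where
  "spherical_gaussian m \<mu> \<sigma> = (\<Pi>\<^sub>M i\<in>{..<m}. density lborel (normal_density (\<mu> i) \<sigma>))"

definition gaussian_mixture ::
    "nat \<Rightarrow> nat \<Rightarrow> (nat \<Rightarrow> nat \<Rightarrow> real) \<Rightarrow> real \<Rightarrow> (nat \<Rightarrow> real) measure" where
  "gaussian_mixture m k \<gamma> \<sigma> =
     Giry_Monad.bind (measure_pmf (pmf_of_set {1..k})) (\<lambda>t. spherical_gaussian m (\<gamma> t) \<sigma>)"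

text \<open>Coordinatewise, \<open>E[X | X \<in> V] = E[X 1\<^sub>V(X)] / P(X \<in> V)\<close>.\<close>

definition voronoi_mean ::
    "nat \<Rightarrow> nat \<Rightarrow> (nat \<Rightarrow> nat \<Rightarrow> real) \<Rightarrow> (nat \<Rightarrow> real) measure \<Rightarrow> nat \<Rightarrow> nat \<Rightarrow> real" where
  "voronoi_mean m k \<gamma> D t =
     (\<lambda>i\<in>{..<m}. (LINT x:voronoi_cell m k \<gamma> t|D. x i) / measure D (voronoi_cell m k \<gamma> t))"

lemma sets_spherical_gaussian:
  "sets (spherical_gaussian m \<mu> \<sigma>) = sets (\<Pi>\<^sub>M i\<in>{..<m}. lborel)"
  unfolding spherical_gaussian_def by (intro sets_PiM_cong) auto

lemma prob_space_spherical_gaussian: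
  assumes "\<sigma> > 0"
  shows "prob_space (spherical_gaussian m \<mu> \<sigma>)"
  unfolding spherical_gaussian_def
  by (intro prob_space_PiM prob_space_normal_density assms)

lemma spherical_gaussian_measurable:
  assumes "\<sigma> > 0"
  shows "(\<lambda>t. spherical_gaussian m (\<gamma> t) \<sigma>)
           \<in> measurable (measure_pmf p) (subprob_algebra (\<Pi>\<^sub>M i\<in>{..<m}. lborel))"
proof -
  have "spherical_gaussian m (\<gamma> t) \<sigma> \<in> space (subprob_algebra (\<Pi>\<^sub>M i\<in>{..<m}. lborel))" for t
    using prob_space_imp_subprob_space[OF prob_space_spherical_gaussian[OF assms]]
    by (simp add: space_subprob_algebra sets_spherical_gaussian)
  then show ?thesis by simp
qed

lemma sets_gaussian_mixture:
  assumes "\<sigma> > 0"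
  shows "sets (gaussian_mixture m k \<gamma> \<sigma>) = sets (\<Pi>\<^sub>M i\<in>{..<m}. lborel)"
  unfolding gaussian_mixture_def
  by (rule sets_bind) (auto simp: sets_spherical_gaussian)

lemma prob_space_gaussian_mixture:
  assumes "\<sigma> > 0"
  shows "prob_space (gaussian_mixture m k \<gamma> \<sigma>)"
  unfolding gaussian_mixture_def
  by (rule prob_space.prob_space_bind[OF prob_space_measure_pmf _ spherical_gaussian_measurable[OF assms]])
     (simp add: prob_space_spherical_gaussian assms)

lemma emeasure_gaussian_mixture:
  assumes "\<sigma> > 0" "k > 0" "A \<in> sets (\<Pi>\<^sub>M i\<in>{..<m}. lborel)"
  shows "emeasure (gaussian_mixture m k \<gamma> \<sigma>) A =
           (\<Sum>t\<in>{1..k}. emeasure (spherical_gaussian m (\<gamma> t) \<sigma>) A) / of_nat k"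
proof -
  have "emeasure (gaussian_mixture m k \<gamma> \<sigma>) A =
          (\<integral>\<^sup>+ t. emeasure (spherical_gaussian m (\<gamma> t) \<sigma>) A \<partial>measure_pmf (pmf_of_set {1..k}))"
    unfolding gaussian_mixture_def
    using emeasure_bind[OF _ spherical_gaussian_measurable[OF assms(1)] assms(3)] by simp
  also have "\<dots> = (\<Sum>t\<in>{1..k}. emeasure (spherical_gaussian m (\<gamma> t) \<sigma>) A) / of_nat k"
    using assms(2) by (subst nn_integral_pmf_of_set) auto
  finally show ?thesis .
qed

end

theory Submission
  imports Defs "HOL-Real_Asymp.Real_Asymp"
begin

text \<open>
  Let \<open>\<gamma> t = s e\<^sub>j\<close> with \<open>s = \<plusminus>1\<close>. On the cell of \<open>t\<close> the number \<open>s x\<^sub>j\<close> is the largest of all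
  \<open>\<bar>x\<^sub>i\<bar>\<close> with \<open>i < d\<close>, where \<open>d = k / 2\<close>. Hence the part of the cell where \<open>s x\<^sub>j < \<alpha> \<sigma> \<surd>(ln k)\<close>
  lies in a cube. The probability of the cube is of order \<open>\<alpha> \<surd>(ln k)\<close> at most, and also at most
  \<open>exp (- const k\<^bsup>1 - \<alpha>\<^sup>2\<^esup>)\<close>. The cell itself has probability at
  least a fixed negative power of \<open>k\<close>, already from the component centred at \<open>\<gamma> t\<close> (so the exact
  symmetry, which gives \<open>1 / k\<close>, is not needed). For a small universal \<open>\<alpha>\<close> the first
  probability is therefore at most half of the second (by the second bound for large \<open>k\<close>, by the first
  one for the finitely many other \<open>k\<close>), and the \<open>j\<close>-th coordinate of the Voronoi mean,
  multiplied by \<open>s\<close>, is at least \<open>\<alpha> \<sigma> \<surd>(ln k) / 2\<close>. If \<open>\<sigma>\<close> is large compared with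
  \<open>1 / \<surd>(ln k)\<close>, this exceeds the coordinate \<open>1\<close> of the centre by a multiple of \<open>\<sigma> \<surd>(ln k)\<close>.
\<close>

section \<open>Elementary bounds in \<open>k\<close> and the universal factor \<alpha>\<close>

abbreviation gauss :: "real \<Rightarrow> real \<Rightarrow> real measure" where
  "gauss \<mu> \<sigma> \<equiv> density lborel (normal_density \<mu> \<sigma>)"

text \<open>The exponent uses \<open>(r + 1)\<^sup>2 / 2 \<le> r\<^sup>2 + 1\<close>, which keeps \<open>tail_bound (c * sqrt (ln k))\<close> a pure
  power of \<open>k\<close>.\<close>

definition tail_bound :: "real \<Rightarrow> real" where
  "tail_bound r = exp (- (r\<^sup>2) - 1) / sqrt (2 * pi)"

text \<open>The factor \<open>1 / k\<close> is the weight of one component; the factor \<open>1 / 2\<close> is lost on the coordinates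
  other than the one along which the centre lies.\<close>

definition cell_bound :: "nat \<Rightarrow> real" where
  "cell_bound k = tail_bound (2 * sqrt (ln (2 * real k))) / (2 * real k)"

lemma tail_bound_pos: "0 < tail_bound r"
  by (simp add: tail_bound_def)

lemma cell_bound_pos: "0 < k \<Longrightarrow> 0 < cell_bound k"
  by (simp add: cell_bound_def tail_bound_pos)

lemma tail_bound_antimono: "0 \<le> r \<Longrightarrow> r \<le> s \<Longrightarrow> tail_bound s \<le> tail_bound r"
  by (auto simp: tail_bound_def intro!: divide_right_mono power_mono)

text \<open>With factor \<open>1/2\<close>, \<open>tail_bound\<close> is a constant times
  \<open>k\<close> to the power \<open>-1/4\<close>, so the exponent on the left is of order
  \<open>k\<close> to the power \<open>3/4\<close>. \<open>cell_bound k\<close> decays only like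
  \<open>k\<close> to the power \<open>-5\<close>.\<close>

lemma eventually_exp_le_cell_bound:
  "\<forall>\<^sub>F k in sequentially.
     exp (- (real k / 2) * tail_bound (1/2 * sqrt (ln (real k)))) \<le> cell_bound k / 2"
proof -
  have "\<forall>\<^sub>F k in sequentially.
      exp (- (real k / 2) * (exp (- (ln (real k) / 4) - 1) / sqrt (2 * pi)))
        \<le> exp (- (4 * ln (2 * real k)) - 1) / sqrt (2 * pi) / (2 * real k) / 2"
    by real_asymp
  with eventually_ge_at_top[of 1] show ?thesis
    by eventually_elim (simp add: tail_bound_def cell_bound_def power_mult_distrib power_divide)
qed

text \<open>The second alternative holds for all large \<open>k\<close> with factor
  \<open>1/2\<close>, and shrinking the factor keeps it true. The finitely many remaining
  \<open>k\<close> are handled by the first alternative, which holds once the factor is small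
  enough.\<close>

lemma exists_threshold_factor:
  "\<exists>\<alpha>>0. \<forall>k\<ge>2. \<alpha> * sqrt (ln (real k)) \<le> cell_bound k / 2 \<or>
     exp (- (real k / 2) * tail_bound (\<alpha> * sqrt (ln (real k)))) \<le> cell_bound k / 2"
proof -
  obtain K where K: "\<And>k. k \<ge> K \<Longrightarrow>
      exp (- (real k / 2) * tail_bound (1/2 * sqrt (ln (real k)))) \<le> cell_bound k / 2"
    using eventually_exp_le_cell_bound by (auto simp: eventually_sequentially)
  \<comment> \<open>\<open>f k\<close> is the largest factor for which the first alternative holds
    at \<open>k\<close>. Inserting \<open>1/2\<close> below caps the minimum and keeps the set
    nonempty when \<open>K\<close> is at most 2.\<close>
  define f where "f k = cell_bound k / 2 / sqrt (ln (real k))" for k :: nat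
  define \<alpha> where "\<alpha> = Min (insert (1/2) (f ` {2..<K}))"
  have "\<alpha> > 0"
    by (auto simp: \<alpha>_def f_def intro!: divide_pos_pos cell_bound_pos)
  moreover have "\<alpha> \<le> 1/2" unfolding \<alpha>_def by (rule Min_le) auto
  moreover have "\<alpha> \<le> f k" if "k \<in> {2..<K}" for k
    unfolding \<alpha>_def by (rule Min_le) (use that in auto)
  ultimately show ?thesis
  proof (intro exI[of _ \<alpha>] conjI allI impI)
    fix k :: nat assume k: "2 \<le> k"
    then have pos: "0 < sqrt (ln (real k))" by simp
    show "\<alpha> * sqrt (ln (real k)) \<le> cell_bound k / 2 \<or>
     exp (- (real k / 2) * tail_bound (\<alpha> * sqrt (ln (real k)))) \<le> cell_bound k / 2"
    proof (cases "k < K")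
      case True
      with k \<open>\<And>k. k \<in> {2..<K} \<Longrightarrow> \<alpha> \<le> f k\<close>[of k] pos show ?thesis
        by (auto simp: f_def pos_le_divide_eq)
    next
      case False
      have "tail_bound (1/2 * sqrt (ln (real k))) \<le> tail_bound (\<alpha> * sqrt (ln (real k)))"
        using \<open>\<alpha> > 0\<close> \<open>\<alpha> \<le> 1/2\<close> pos by (intro tail_bound_antimono mult_right_mono) auto
      then have "exp (- (real k / 2) * tail_bound (\<alpha> * sqrt (ln (real k)))) \<le>
        exp (- (real k / 2) * tail_bound (1/2 * sqrt (ln (real k))))"
        by (simp add: mult_left_mono)
      with K[of k] False show ?thesis by linarith
    qed
  qed
qed

section \<open>One-dimensional Gaussian estimates\<close>

text \<open>Up to distance \<open>(r + 1) * \<sigma>\<close> from the mean the density is at least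
  \<open>tail_bound r / \<sigma>\<close>, and the length \<sigma> of the interval cancels the
  denominator.\<close>

lemma measure_gauss_interval_ge:
  assumes "\<sigma> > 0" and near: "\<And>x. x \<in> {l..l+\<sigma>} \<Longrightarrow> \<bar>x - \<mu>\<bar> \<le> (r + 1) * \<sigma>"
  shows "tail_bound r \<le> measure (gauss \<mu> \<sigma>) {l..l+\<sigma>}"
proof -
  interpret prob_space "gauss \<mu> \<sigma>" by (rule prob_space_normal_density[OF assms(1)])
  have "tail_bound r / \<sigma> \<le> normal_density \<mu> \<sigma> x" if "x \<in> {l..l+\<sigma>}" for x
  proof -
    have "(r + 1)\<^sup>2 \<le> 2 * (r\<^sup>2 + 1)"
      using zero_le_power2[of "r - 1"] by (simp add: power2_eq_square algebra_simps)
    have "\<bar>x - \<mu>\<bar>\<^sup>2 \<le> ((r + 1) * \<sigma>)\<^sup>2" by (rule power_mono[OF near[OF that]]) simp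
    also have "\<dots> \<le> 2 * (r\<^sup>2 + 1) * \<sigma>\<^sup>2"
      using \<open>(r + 1)\<^sup>2 \<le> 2 * (r\<^sup>2 + 1)\<close> by (simp only: power_mult_distrib mult_right_mono zero_le_power2)
    finally have "(x - \<mu>)\<^sup>2 / (2 * \<sigma>\<^sup>2) \<le> r\<^sup>2 + 1"
      using assms(1) by (simp add: divide_le_eq algebra_simps)
    then have "exp (- (r\<^sup>2) - 1) \<le> exp (- (x - \<mu>)\<^sup>2 / (2 * \<sigma>\<^sup>2))" by simp
    then have "exp (- (r\<^sup>2) - 1) / (sqrt (2 * pi) * \<sigma>) \<le> exp (- (x - \<mu>)\<^sup>2 / (2 * \<sigma>\<^sup>2)) / (sqrt (2 * pi) * \<sigma>)"
      using assms(1) by (intro divide_right_mono) auto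
    then show ?thesis
      using assms(1) by (simp add: normal_density_def tail_bound_def real_sqrt_mult)
  qed
  then have "(\<integral>\<^sup>+x. ennreal (tail_bound r / \<sigma>) * indicator {l..l+\<sigma>} x \<partial>lborel)
      \<le> (\<integral>\<^sup>+x. ennreal (normal_density \<mu> \<sigma> x) * indicator {l..l+\<sigma>} x \<partial>lborel)"
    by (intro nn_integral_mono) (auto split: split_indicator intro!: ennreal_leI)
  also have "(\<integral>\<^sup>+x. ennreal (tail_bound r / \<sigma>) * indicator {l..l+\<sigma>} x \<partial>lborel) = ennreal (tail_bound r)"
    using assms(1) tail_bound_pos[of r]
    by (simp add: nn_integral_cmult_indicator flip: ennreal_mult)
  also have "(\<integral>\<^sup>+x. ennreal (normal_density \<mu> \<sigma> x) * indicator {l..l+\<sigma>} x \<partial>lborel) = emeasure (gauss \<mu> \<sigma>) {l..l+\<sigma>}"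
    by (simp add: emeasure_density)
  finally show ?thesis by (simp add: emeasure_eq_measure)
qed

text \<open>The bound is uniform in \<mu>, so that it applies to every component of the mixture. It
  comes from an interval of length \<sigma> that avoids the ball around 0 yet stays within
  \<open>(r + 1) * \<sigma>\<close> of \<mu>.\<close>

lemma measure_gauss_concentration_le:
  assumes "\<sigma> > 0" "0 \<le> r"
  shows "measure (gauss \<mu> \<sigma>) {-r*\<sigma><..<r*\<sigma>} \<le> 1 - tail_bound r"
proof -
  interpret prob_space "gauss \<mu> \<sigma>" by (rule prob_space_normal_density[OF assms(1)])
  \<comment> \<open>The interval starts at distance \<open>r * \<sigma>\<close> from \<mu>, on the
    side facing away from 0. On the left, the extra \<sigma> appears because \<open>l\<close> is the
    left endpoint.\<close>
  define l where "l = (if \<mu> \<ge> 0 then \<mu> + r * \<sigma> else \<mu> - r * \<sigma> - \<sigma>)"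
  have "0 \<le> r * \<sigma>" using assms by simp
  then have "tail_bound r \<le> prob {l..l+\<sigma>}"
    using assms(1) by (intro measure_gauss_interval_ge) (simp_all add: l_def distrib_right abs_le_iff split: if_splits)
  also have "\<dots> \<le> prob (- {-r*\<sigma><..<r*\<sigma>})"
    using assms by (intro finite_measure_mono) (auto simp: l_def)
  also have "\<dots> = 1 - prob {-r*\<sigma><..<r*\<sigma>}"
    using prob_compl[of "{-r*\<sigma><..<r*\<sigma>}"] by (simp add: Compl_eq_Diff_UNIV)
  finally show ?thesis by simp
qed

text \<open>The density never exceeds \<open>1 / (2 * \<sigma>)\<close>, and the ball has length
  \<open>2 * r * \<sigma>\<close>. This is again uniform in \<mu>.\<close>

lemma measure_gauss_small_ball_le:
  assumes "\<sigma> > 0" "0 \<le> r"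
  shows "measure (gauss \<mu> \<sigma>) {-r*\<sigma><..<r*\<sigma>} \<le> r"
proof -
  interpret prob_space "gauss \<mu> \<sigma>" by (rule prob_space_normal_density[OF assms(1)])
  have "2 = sqrt (2\<^sup>2)" by simp
  also have "\<dots> \<le> sqrt (2 * pi)" using pi_gt3 by (intro real_sqrt_le_mono) simp
  finally have s: "2 \<le> sqrt (2 * pi)" .
  have "normal_density \<mu> \<sigma> x \<le> 1 / (2 * \<sigma>)" for x
  proof -
    have "normal_density \<mu> \<sigma> x \<le> 1 / (sqrt (2 * pi) * \<sigma>)"
      using assms(1) by (simp add: normal_density_def real_sqrt_mult divide_right_mono)
    also have "\<dots> \<le> 1 / (2 * \<sigma>)"
      using assms(1) s by (intro divide_left_mono mult_right_mono) auto
    finally show ?thesis .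
  qed
  then have "(\<integral>\<^sup>+x. ennreal (normal_density \<mu> \<sigma> x) * indicator {-r*\<sigma><..<r*\<sigma>} x \<partial>lborel)
     \<le> (\<integral>\<^sup>+x. ennreal (1 / (2 * \<sigma>)) * indicator {-r*\<sigma><..<r*\<sigma>} x \<partial>lborel)"
    by (intro nn_integral_mono) (auto split: split_indicator intro!: ennreal_leI)
  also have "\<dots> = ennreal r"
    using assms by (simp add: nn_integral_cmult_indicator flip: ennreal_mult)
  also have "(\<integral>\<^sup>+x. ennreal (normal_density \<mu> \<sigma> x) * indicator {-r*\<sigma><..<r*\<sigma>} x \<partial>lborel)
      = emeasure (gauss \<mu> \<sigma>) {-r*\<sigma><..<r*\<sigma>}"
    by (simp add: emeasure_density)
  finally show ?thesis using assms by (simp add: emeasure_eq_measure)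
qed

lemma measure_gauss_concentration_ge:
  assumes "\<sigma> > 0" "0 \<le> r"
  shows "1 - sqrt 2 * exp (- r\<^sup>2 / 4) \<le> measure (gauss 0 \<sigma>) {-r*\<sigma><..<r*\<sigma>}"
proof -
  interpret prob_space "gauss 0 \<sigma>" by (rule prob_space_normal_density[OF assms(1)])
  interpret wide: prob_space "gauss 0 (sqrt 2 * \<sigma>)"
    by (rule prob_space_normal_density) (use assms in simp)
  let ?A = "- {-r*\<sigma><..<r*\<sigma>}" and ?c = "sqrt 2 * exp (- r\<^sup>2 / 4)"
  \<comment> \<open>Doubling the variance absorbs half of the exponent, which gives the tail bound without integrating.\<close>
  have "normal_density 0 \<sigma> x \<le> ?c * normal_density 0 (sqrt 2 * \<sigma>) x" if "x \<in> ?A" for x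
  proof -
    have "r * \<sigma> \<le> \<bar>x\<bar>" using that by auto
    then have "(r * \<sigma>)\<^sup>2 \<le> \<bar>x\<bar>\<^sup>2" using assms by (intro power_mono) auto
    then have "r\<^sup>2 \<le> x\<^sup>2 / \<sigma>\<^sup>2"
      using assms(1) by (simp add: le_divide_eq power_mult_distrib)
    then have "r\<^sup>2 / 4 + x\<^sup>2 / (4 * \<sigma>\<^sup>2) \<le> x\<^sup>2 / (2 * \<sigma>\<^sup>2)" by (simp add: field_simps)
    then have "exp (- x\<^sup>2 / (2 * \<sigma>\<^sup>2)) \<le> exp (- r\<^sup>2 / 4) * exp (- x\<^sup>2 / (4 * \<sigma>\<^sup>2))"
      by (simp flip: exp_add)
    then have "exp (- x\<^sup>2 / (2 * \<sigma>\<^sup>2)) / (sqrt (2 * pi) * \<sigma>)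
        \<le> exp (- r\<^sup>2 / 4) * exp (- x\<^sup>2 / (4 * \<sigma>\<^sup>2)) / (sqrt (2 * pi) * \<sigma>)"
      using assms(1) by (intro divide_right_mono) auto
    moreover have "normal_density 0 \<sigma> x = exp (- x\<^sup>2 / (2 * \<sigma>\<^sup>2)) / (sqrt (2 * pi) * \<sigma>)"
      using assms(1) by (simp add: normal_density_def real_sqrt_mult)
    moreover have "?c * normal_density 0 (sqrt 2 * \<sigma>) x
        = exp (- r\<^sup>2 / 4) * exp (- x\<^sup>2 / (4 * \<sigma>\<^sup>2)) / (sqrt (2 * pi) * \<sigma>)"
      using assms(1) by (simp add: normal_density_def real_sqrt_mult power_mult_distrib field_simps)
    ultimately show ?thesis by simp
  qed
  then have "(\<integral>\<^sup>+x. ennreal (normal_density 0 \<sigma> x) * indicator ?A x \<partial>lborel)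
     \<le> (\<integral>\<^sup>+x. ennreal ?c * (ennreal (normal_density 0 (sqrt 2 * \<sigma>) x) * indicator ?A x) \<partial>lborel)"
    by (intro nn_integral_mono) (auto split: split_indicator intro!: ennreal_leI simp flip: ennreal_mult)
  also have "\<dots> = ennreal ?c * emeasure (gauss 0 (sqrt 2 * \<sigma>)) ?A"
    by (simp add: nn_integral_cmult emeasure_density)
  also have "\<dots> \<le> ennreal ?c * 1"
    by (intro mult_left_mono wide.emeasure_le_1) simp
  also have "(\<integral>\<^sup>+x. ennreal (normal_density 0 \<sigma> x) * indicator ?A x \<partial>lborel) = emeasure (gauss 0 \<sigma>) ?A"
    by (simp add: emeasure_density)
  finally have "prob ?A \<le> ?c" by (simp add: emeasure_eq_measure)
  moreover have "prob ?A = 1 - prob {-r*\<sigma><..<r*\<sigma>}"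
    using prob_compl[of "{-r*\<sigma><..<r*\<sigma>}"] by (simp add: Compl_eq_Diff_UNIV)
  ultimately show ?thesis by simp
qed

section \<open>Reduction of the spherical Gaussian and the mixture to single coordinates\<close>

lemma measure_spherical_gaussian_PiE:
  assumes "\<sigma> > 0" "\<And>i. i < m \<Longrightarrow> A i \<in> sets borel"
  shows "measure (spherical_gaussian m \<mu> \<sigma>) (PiE {..<m} A) = (\<Prod>i<m. measure (gauss (\<mu> i) \<sigma>) (A i))"
proof -
  interpret finite_product_prob_space "\<lambda>i. gauss (\<mu> i) \<sigma>" "{..<m}"
    by (simp add: finite_product_prob_space_def product_prob_space_def product_prob_space_axioms_def
        product_sigma_finite_def finite_product_sigma_finite_def finite_product_sigma_finite_axioms_def
        prob_space_normal_density[OF assms(1)] prob_space_imp_sigma_finite)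
  show ?thesis unfolding spherical_gaussian_def
    using assms(2) by (intro prob_times) auto
qed

lemma nn_integral_component_spherical_gaussian:
  assumes "\<sigma> > 0" "j < m" "f \<in> borel_measurable borel"
  shows "(\<integral>\<^sup>+x. f (x j) \<partial>spherical_gaussian m \<mu> \<sigma>) = (\<integral>\<^sup>+x. f x \<partial>gauss (\<mu> j) \<sigma>)"
proof -
  have "gauss (\<mu> j) \<sigma> = distr (spherical_gaussian m \<mu> \<sigma>) (gauss (\<mu> j) \<sigma>) (\<lambda>x. x j)"
    unfolding spherical_gaussian_def using assms
    by (intro distr_PiM_component[symmetric] prob_space_normal_density) auto
  also have "(\<integral>\<^sup>+x. f x \<partial>\<dots>) = (\<integral>\<^sup>+x. f (x j) \<partial>spherical_gaussian m \<mu> \<sigma>)"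
    using assms(2,3) unfolding spherical_gaussian_def
    by (intro nn_integral_distr) auto
  finally show ?thesis ..
qed

lemma nn_integral_gaussian_mixture:
  assumes "\<sigma> > 0" "k > 0" "f \<in> borel_measurable (\<Pi>\<^sub>M i\<in>{..<m}. lborel)"
  shows "(\<integral>\<^sup>+x. f x \<partial>gaussian_mixture m k \<gamma> \<sigma>)
    = (\<Sum>t\<in>{1..k}. \<integral>\<^sup>+x. f x \<partial>spherical_gaussian m (\<gamma> t) \<sigma>) / of_nat k"
proof -
  have "(\<integral>\<^sup>+x. f x \<partial>gaussian_mixture m k \<gamma> \<sigma>) =
    (\<integral>\<^sup>+t. (\<integral>\<^sup>+x. f x \<partial>spherical_gaussian m (\<gamma> t) \<sigma>) \<partial>measure_pmf (pmf_of_set {1..k}))"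
    unfolding gaussian_mixture_def
    by (rule nn_integral_bind[OF assms(3) spherical_gaussian_measurable[OF assms(1)]])
  also have "\<dots> = (\<Sum>t\<in>{1..k}. \<integral>\<^sup>+x. f x \<partial>spherical_gaussian m (\<gamma> t) \<sigma>) / of_nat k"
    using assms(2) by (subst nn_integral_pmf_of_set) auto
  finally show ?thesis .
qed

text \<open>Reduces to the first absolute moment of a normal distribution. Without integrability the
  Bochner integral in \<open>voronoi_mean\<close> would default to 0 and could not be bounded by
  monotonicity.\<close>

lemma integrable_component_gaussian_mixture:
  assumes "\<sigma> > 0" "k > 0" "j < m"
  shows "integrable (gaussian_mixture m k \<gamma> \<sigma>) (\<lambda>x. x j)"
proof (rule integrableI_bounded)
  have "(\<integral>\<^sup>+x. ennreal \<bar>x j\<bar> \<partial>spherical_gaussian m (\<gamma> t) \<sigma>) < \<infinity>" for t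
  proof -
    have "integrable lborel (\<lambda>x. normal_density (\<gamma> t j) \<sigma> x * x)"
      using integrable_normal_moment_nz_1[OF assms(1)] .
    then have "integrable (gauss (\<gamma> t j) \<sigma>) (\<lambda>x. x)"
      by (subst integrable_density) (auto simp: mult.commute)
    then have "(\<integral>\<^sup>+x. ennreal \<bar>x\<bar> \<partial>gauss (\<gamma> t j) \<sigma>) < \<infinity>"
      by (simp add: integrable_iff_bounded)
    then show ?thesis
      using assms by (subst nn_integral_component_spherical_gaussian) auto
  qed
  then have "(\<integral>\<^sup>+x. ennreal \<bar>x j\<bar> \<partial>gaussian_mixture m k \<gamma> \<sigma>) < \<infinity>"
    using assms by (subst nn_integral_gaussian_mixture) (auto simp: ennreal_divide_eq_top_iff simp flip: less_top)
  then show "(\<integral>\<^sup>+x. ennreal (norm (x j)) \<partial>gaussian_mixture m k \<gamma> \<sigma>) < \<infinity>" by simp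
  have "(\<lambda>x. x j) \<in> borel_measurable (\<Pi>\<^sub>M i\<in>{..<m}. lborel)"
    using measurable_component_singleton[of j "{..<m}" "\<lambda>_. lborel"] assms(3) by simp
  then show "(\<lambda>x. x j) \<in> borel_measurable (gaussian_mixture m k \<gamma> \<sigma>)"
    by (simp add: measurable_cong_sets[OF sets_gaussian_mixture[OF assms(1)] refl])
qed

lemma measure_gaussian_mixture:
  assumes "\<sigma> > 0" "k > 0" "A \<in> sets (\<Pi>\<^sub>M i\<in>{..<m}. lborel)"
  shows "measure (gaussian_mixture m k \<gamma> \<sigma>) A =
           (\<Sum>t\<in>{1..k}. measure (spherical_gaussian m (\<gamma> t) \<sigma>) A) / real k"
proof -
  interpret D: prob_space "gaussian_mixture m k \<gamma> \<sigma>" by (rule prob_space_gaussian_mixture[OF assms(1)])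
  interpret S: prob_space "spherical_gaussian m (\<gamma> t) \<sigma>" for t by (rule prob_space_spherical_gaussian[OF assms(1)])
  have "ennreal (measure (gaussian_mixture m k \<gamma> \<sigma>) A) = ennreal ((\<Sum>t\<in>{1..k}. measure (spherical_gaussian m (\<gamma> t) \<sigma>) A) / real k)"
    using emeasure_gaussian_mixture[OF assms, of \<gamma>] assms(2)
    by (simp add: D.emeasure_eq_measure S.emeasure_eq_measure sum_nonneg flip: divide_ennreal ennreal_of_nat_eq_real_of_nat)
  then show ?thesis by (simp add: sum_nonneg)
qed


section \<open>Geometry of the orthoplex and its Voronoi cells\<close>

text \<open>Carrying the sign as a parameter lets one argument cover both halves of the
  orthoplex.\<close>

definition signed_basis :: "nat \<Rightarrow> nat \<Rightarrow> real \<Rightarrow> nat \<Rightarrow> real" where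
  "signed_basis m j s = (\<lambda>i\<in>{..<m}. if i = j then s else 0)"

lemma standard_orthoplex_eq:
  "standard_orthoplex m d = {signed_basis m j s | j s. j < d \<and> s \<in> {1, -1}}"
proof -
  have "id_column m j = signed_basis m j 1" for j
    by (simp add: id_column_def signed_basis_def)
  moreover have "(\<lambda>i\<in>{..<m}. - id_column m j i) = signed_basis m j (-1)" for j
    by (auto simp: id_column_def signed_basis_def)
  ultimately show ?thesis by (auto simp: standard_orthoplex_def)
qed

lemma signed_basis_eq_iff:
  assumes "j < m" "i < m" "s \<noteq> 0"
  shows "signed_basis m j s = signed_basis m i r \<longleftrightarrow> j = i \<and> s = r"
proof
  assume "signed_basis m j s = signed_basis m i r"
  then have "signed_basis m j s j = signed_basis m i r j" by simp
  then show "j = i \<and> s = r" using assms by (auto simp: signed_basis_def split: if_splits)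
qed simp

lemma vdist_signed_basis_sq:
  assumes "j < m" "s \<in> {1, -1}"
  shows "(vdist m x (signed_basis m j s))\<^sup>2 = (\<Sum>i<m. (x i)\<^sup>2) + 1 - 2 * (s * x j)"
proof -
  have "(vdist m x (signed_basis m j s))\<^sup>2 = (\<Sum>i<m. (x i - signed_basis m j s i)\<^sup>2)"
    by (simp add: vdist_def L2_set_def sum_nonneg)
  also have "\<dots> = (\<Sum>i<m. (x i)\<^sup>2 + (if i = j then s\<^sup>2 - 2 * (s * x j) else 0))"
    by (intro sum.cong) (auto simp: signed_basis_def power2_eq_square algebra_simps)
  also have "\<dots> = (\<Sum>i<m. (x i)\<^sup>2) + (s\<^sup>2 - 2 * (s * x j))"
    using assms(1) by (simp add: sum.distrib)
  finally show ?thesis using assms(2) by auto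
qed

text \<open>All vertices have norm 1, so squared distances from \<open>x\<close> differ only in the
  inner product with the vertex. The cells are therefore cut out by linear inequalities.\<close>

lemma vdist_signed_basis_less_iff:
  assumes "j < m" "s \<in> {1, -1}" "i < m" "r \<in> {1, -1}"
  shows "vdist m x (signed_basis m j s) < vdist m x (signed_basis m i r) \<longleftrightarrow> r * x i < s * x j"
proof -
  have nn: "0 \<le> vdist m x y" for y by (simp add: vdist_def)
  have "vdist m x (signed_basis m j s) < vdist m x (signed_basis m i r) \<longleftrightarrow>
      (vdist m x (signed_basis m j s))\<^sup>2 < (vdist m x (signed_basis m i r))\<^sup>2"
    using power_strict_mono[OF _ nn, of _ _ 2] power_less_imp_less_base[OF _ nn, of _ 2] by auto
  then show ?thesis using assms by (simp add: vdist_signed_basis_sq)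
qed

lemma abs_component_le_vdist: "i < m \<Longrightarrow> \<bar>x i - y i\<bar> \<le> vdist m x y"
  unfolding vdist_def
  using member_le_L2_set[of "{..<m}" i "\<lambda>i. \<bar>x i - y i\<bar>"] by (simp add: L2_set_def)

lemma measurable_vdist [measurable]: "(\<lambda>x. vdist m x y) \<in> borel_measurable (\<Pi>\<^sub>M i\<in>{..<m}. lborel)"
proof -
  have [measurable]: "(\<lambda>x. x i) \<in> borel_measurable (\<Pi>\<^sub>M i\<in>{..<m}. lborel)" if "i < m" for i
    using measurable_component_singleton[of i "{..<m}" "\<lambda>_. lborel"] that by simp
  show ?thesis unfolding vdist_def L2_set_def by measurable
qed

lemma sets_voronoi_cell: "voronoi_cell m k \<gamma> t \<in> sets (\<Pi>\<^sub>M i\<in>{..<m}. lborel)"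
proof -
  have "voronoi_cell m k \<gamma> t = {x \<in> space (\<Pi>\<^sub>M i\<in>{..<m}. (lborel :: real measure)).
      \<forall>b\<in>{1..k}. b \<noteq> t \<longrightarrow> vdist m x (\<gamma> t) < vdist m x (\<gamma> b)}"
    by (simp add: voronoi_cell_def space_PiM)
  then show ?thesis by simp
qed

text \<open>The enumeration \<gamma> is an arbitrary bijection; \<open>center_cases\<close> and
  \<open>index_of_center\<close> translate between indices and signed basis vectors.\<close>

locale orthoplex_mixture =
  fixes m d k :: nat and \<gamma> :: "nat \<Rightarrow> nat \<Rightarrow> real" and \<sigma> :: real
  assumes d_pos: "0 < d" and d_le: "d \<le> m" and k_eq: "k = 2 * d"
    and bij: "bij_betw \<gamma> {1..k} (standard_orthoplex m d)" and \<sigma>_pos: "0 < \<sigma>"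
begin

lemma k_pos: "0 < k" using d_pos k_eq by simp

lemma center_cases:
  assumes "t \<in> {1..k}"
  obtains j s where "j < d" "s \<in> {1, -1}" "\<gamma> t = signed_basis m j s"
proof -
  have "\<gamma> t \<in> standard_orthoplex m d" using bij_betwE[OF bij] assms by blast
  then show thesis using that unfolding standard_orthoplex_eq by blast
qed

lemma index_of_center:
  assumes "j < d" "s \<in> {1, -1}"
  obtains t where "t \<in> {1..k}" "\<gamma> t = signed_basis m j s"
proof -
  have "signed_basis m j s \<in> standard_orthoplex m d"
    using assms by (auto simp: standard_orthoplex_eq)
  then show thesis using that bij_betw_imp_surj_on[OF bij] by (metis imageE)
qed

text \<open>At the coordinate \<open>j\<close> where one vertex is 1 or -1, any other vertex is 0 or
  has the opposite sign. This crude bound suffices because constants are absorbed into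
  \<open>C\<close>.\<close>

lemma min_separation_ge_one: "1 \<le> min_separation m k \<gamma>"
proof -
  let ?S = "{vdist m (\<gamma> a) (\<gamma> b) | a b. a \<in> {1..k} \<and> b \<in> {1..k} \<and> a \<noteq> b}"
  have "?S \<subseteq> (\<lambda>(a, b). vdist m (\<gamma> a) (\<gamma> b)) ` ({1..k} \<times> {1..k})" by auto
  then have "finite ?S" by (rule finite_subset) simp
  moreover have "vdist m (\<gamma> 1) (\<gamma> 2) \<in> ?S" using d_pos k_eq by (intro CollectI exI[of _ 1] exI[of _ 2]) auto
  then have "?S \<noteq> {}" by blast
  moreover have "1 \<le> vdist m (\<gamma> a) (\<gamma> b)" if ab: "a \<in> {1..k}" "b \<in> {1..k}" "a \<noteq> b" for a b
  proof -
    obtain j s where j: "j < d" "s \<in> {1, -1}" "\<gamma> a = signed_basis m j s"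
      using center_cases[OF ab(1)] .
    obtain i r where i: "i < d" "r \<in> {1, -1}" "\<gamma> b = signed_basis m i r"
      using center_cases[OF ab(2)] .
    have "\<gamma> a \<noteq> \<gamma> b" using bij_betw_imp_inj_on[OF bij] ab by (auto dest: inj_onD)
    then have "1 \<le> \<bar>\<gamma> a j - \<gamma> b j\<bar>"
      using i j d_le by (auto simp: signed_basis_def)
    also have "\<dots> \<le> vdist m (\<gamma> a) (\<gamma> b)"
      using j d_le by (intro abs_component_le_vdist) simp
    finally show ?thesis .
  qed
  ultimately show ?thesis unfolding min_separation_def by (subst Min_ge_iff) auto
qed

context
  fixes t j s
  assumes t: "t \<in> {1..k}" and j: "j < d" and s: "s \<in> {1, -1}" and center: "\<gamma> t = signed_basis m j s"
begin

lemma j_less_m: "j < m" using j d_le by simp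

text \<open>Comparison with both vertices on axis \<open>i\<close>. The inequality is weak because
  one of them may be \<gamma> \<open>t\<close> itself. The case \<open>i = j\<close> gives
  nonnegativity of \<open>s * x j\<close>.\<close>

lemma abs_le_of_mem_voronoi_cell:
  assumes "x \<in> voronoi_cell m k \<gamma> t" "i < d"
  shows "\<bar>x i\<bar> \<le> s * x j"
proof -
  have "r * x i \<le> s * x j" if r: "r \<in> {1, -1}" for r
  proof -
    obtain b where b: "b \<in> {1..k}" "\<gamma> b = signed_basis m i r"
      using index_of_center[OF assms(2) r] .
    show ?thesis
    proof (cases "b = t")
      case True
      then show ?thesis using b center signed_basis_eq_iff[of j m i s r] j assms(2) d_le s by auto
    next
      case False
      then have "vdist m x (\<gamma> t) < vdist m x (\<gamma> b)"
        using assms(1) b(1) unfolding voronoi_cell_def by blast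
      then show ?thesis
        using vdist_signed_basis_less_iff[of j m s i r x] b center j assms(2) d_le s r by auto
    qed
  qed
  from this[of 1] this[of "-1"] show ?thesis by auto
qed

text \<open>Positivity of \<open>s * x j\<close> excludes the antipodal vertex; the third assumption
  excludes all vertices on other axes.\<close>

lemma mem_voronoi_cellI:
  assumes "x \<in> {..<m} \<rightarrow>\<^sub>E UNIV" "0 < s * x j" "\<And>i. i < d \<Longrightarrow> i \<noteq> j \<Longrightarrow> \<bar>x i\<bar> < s * x j"
  shows "x \<in> voronoi_cell m k \<gamma> t"
proof -
  have "vdist m x (\<gamma> t) < vdist m x (\<gamma> b)" if b: "b \<in> {1..k}" "b \<noteq> t" for b
  proof -
    obtain i r where i: "i < d" "r \<in> {1, -1}" "\<gamma> b = signed_basis m i r"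
      using center_cases[OF b(1)] .
    have "\<gamma> b \<noteq> \<gamma> t" using bij_betw_imp_inj_on[OF bij] b t by (auto dest: inj_onD)
    then have "i \<noteq> j \<or> r = - s" using i s center by auto
    then have "r * x i < s * x j"
      using assms(2) assms(3)[OF i(1)] i(2) by fastforce
    then show ?thesis
      using vdist_signed_basis_less_iff[of j m s i r x] i center j d_le s by auto
  qed
  with assms(1) show ?thesis by (simp add: voronoi_cell_def)
qed

section \<open>Probabilities of the cell and of its part near the origin, and the Voronoi
  mean\<close>

interpretation D: prob_space "gaussian_mixture m k \<gamma> \<sigma>"
  by (rule prob_space_gaussian_mixture[OF \<sigma>_pos])

interpretation S: prob_space "spherical_gaussian m (\<gamma> u) \<sigma>" for u
  by (rule prob_space_spherical_gaussian[OF \<sigma>_pos])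

text \<open>The cell contains a box on which coordinate \<open>j\<close> lies beyond level
  \<open>1 + M * \<sigma>\<close> and the other coordinates below \<open>d\<close> stay within
  \<open>M * \<sigma>\<close>. Under the component at \<gamma> \<open>t\<close> the first condition
  costs \<open>tail_bound M\<close> and the others together at most a factor
  \<open>1/2\<close>.\<close>

lemma cell_bound_le_measure_voronoi_cell:
  "cell_bound k \<le> measure (gaussian_mixture m k \<gamma> \<sigma>) (voronoi_cell m k \<gamma> t)"
proof -
  \<comment> \<open>Chosen so that the Gaussian tail at \<open>M\<close> is below \<open>1 / k\<close>.\<close>
  define M where "M = 2 * sqrt (ln (2 * real k))"
  have "0 < ln (2 * real k)" using k_pos by (intro ln_gt_zero) auto
  then have M: "0 < M" "M\<^sup>2 / 4 = ln (2 * real k)" by (simp_all add: M_def power_mult_distrib)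
  define l where "l = (if s = 1 then 1 + M * \<sigma> else - (1 + M * \<sigma> + \<sigma>))"
  define A where "A i = (if i = j then {l..l+\<sigma>} else if i < d then {-M*\<sigma><..<M*\<sigma>} else UNIV)" for i
  have "PiE {..<m} A \<subseteq> voronoi_cell m k \<gamma> t"
  proof
    fix x assume x: "x \<in> PiE {..<m} A"
    have "x j \<in> {l..l+\<sigma>}" using PiE_mem[OF x, of j] j_less_m by (simp add: A_def)
    then have "1 + M * \<sigma> \<le> s * x j" using s by (auto simp: l_def)
    moreover have "\<bar>x i\<bar> < M * \<sigma>" if "i < d" "i \<noteq> j" for i
      using PiE_mem[OF x, of i] that d_le by (auto simp: A_def abs_less_iff)
    moreover have "x \<in> {..<m} \<rightarrow>\<^sub>E UNIV" using x by (auto simp: PiE_def)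
    moreover have "0 < M * \<sigma>" using M \<sigma>_pos by simp
    ultimately show "x \<in> voronoi_cell m k \<gamma> t"
      by (intro mem_voronoi_cellI) (force, linarith, fastforce)
  qed
  then have "measure (spherical_gaussian m (\<gamma> t) \<sigma>) (PiE {..<m} A)
      \<le> measure (spherical_gaussian m (\<gamma> t) \<sigma>) (voronoi_cell m k \<gamma> t)"
    by (intro S.finite_measure_mono) (simp_all add: sets_spherical_gaussian sets_voronoi_cell)
  moreover have "measure (spherical_gaussian m (\<gamma> t) \<sigma>) (PiE {..<m} A)
      = (\<Prod>i<m. measure (gauss (\<gamma> t i) \<sigma>) (A i))"
    by (intro measure_spherical_gaussian_PiE \<sigma>_pos) (simp add: A_def)
  moreover have "tail_bound M * (1 / 2) \<le> (\<Prod>i<m. measure (gauss (\<gamma> t i) \<sigma>) (A i))"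
  proof -
    let ?c = "1 - sqrt 2 * exp (- M\<^sup>2 / 4)"
    have c: "?c = 1 - sqrt 2 / (2 * real k)"
      using M k_pos by (simp add: exp_minus inverse_eq_divide)
    have "sqrt 2 / (2 * real k) \<le> 2 / (2 * real k)"
      using k_pos sqrt2_less_2 by (intro divide_right_mono) auto
    also have "\<dots> = 1 / real k" by simp
    finally have c_ge: "1 - 1 / real k \<le> ?c" using c by linarith
    have "1 / real k \<le> 1" using k_pos by simp
    then have c_nonneg: "0 \<le> ?c" and c_le: "?c \<le> 1" using c_ge by auto
    \<comment> \<open>Each of the \<open>d - 1\<close> other coordinates fails with probability at
      most \<open>1 / k\<close>. Bernoulli's inequality with exponent \<open>d\<close> gives exactly
      \<open>1/2\<close>, since \<open>k = 2 * d\<close>.\<close>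
    have "1 / 2 \<le> 1 + real d * - (1 / real k)" using d_pos by (simp add: k_eq)
    also have "\<dots> \<le> (1 + - (1 / real k)) ^ d"
      using k_pos by (intro Bernoulli_inequality) simp
    also have "\<dots> \<le> ?c ^ d" using c_ge k_pos by (intro power_mono) auto
    also have "?c ^ d \<le> ?c ^ card ({..<d} - {j})"
      using c_nonneg c_le j by (intro power_decreasing) auto
    also have "\<dots> = (\<Prod>i\<in>{..<d} - {j}. ?c)" by simp
    also have "\<dots> \<le> (\<Prod>i\<in>{..<d} - {j}. measure (gauss (\<gamma> t i) \<sigma>) (A i))"
    proof (intro prod_mono conjI)
      fix i assume i: "i \<in> {..<d} - {j}"
      then have "\<gamma> t i = 0" using d_le by (simp add: center signed_basis_def)
      then show "?c \<le> measure (gauss (\<gamma> t i) \<sigma>) (A i)"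
        using measure_gauss_concentration_ge[OF \<sigma>_pos, of M] M i by (simp add: A_def)
      show "0 \<le> ?c" by (rule c_nonneg)
    qed
    also have "\<dots> = (\<Prod>i\<in>{..<m} - {j}. measure (gauss (\<gamma> t i) \<sigma>) (A i))"
      using d_le prob_space.prob_space[OF prob_space_normal_density[OF \<sigma>_pos]]
      by (intro prod.mono_neutral_left) (auto simp: A_def)
    finally have rest: "1 / 2 \<le> (\<Prod>i\<in>{..<m} - {j}. measure (gauss (\<gamma> t i) \<sigma>) (A i))" .
    have "\<gamma> t j = s" using j_less_m by (simp add: center signed_basis_def)
    have "\<bar>x - \<gamma> t j\<bar> \<le> (M + 1) * \<sigma>" if "x \<in> {l..l+\<sigma>}" for x
    proof -
      have "l \<le> x" "x \<le> l + \<sigma>" using that by auto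
      moreover have "s = 1 \<and> l = 1 + M * \<sigma> \<or> s = -1 \<and> l = - (1 + M * \<sigma> + \<sigma>)"
        using s by (auto simp: l_def)
      moreover have "0 < M * \<sigma>" using M \<sigma>_pos by simp
      moreover have "(M + 1) * \<sigma> = M * \<sigma> + \<sigma>" by (simp add: distrib_right)
      ultimately show ?thesis using \<open>\<gamma> t j = s\<close> \<sigma>_pos by linarith
    qed
    then have "tail_bound M \<le> measure (gauss (\<gamma> t j) \<sigma>) (A j)"
      unfolding A_def if_P[OF refl] by (intro measure_gauss_interval_ge \<sigma>_pos)
    then have "tail_bound M * (1 / 2)
        \<le> measure (gauss (\<gamma> t j) \<sigma>) (A j) * (\<Prod>i\<in>{..<m} - {j}. measure (gauss (\<gamma> t i) \<sigma>) (A i))"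
      using rest tail_bound_pos[of M] by (intro mult_mono) auto
    also have "\<dots> = (\<Prod>i<m. measure (gauss (\<gamma> t i) \<sigma>) (A i))"
      using j_less_m by (subst prod.remove[of _ j]) auto
    finally show ?thesis .
  qed
  ultimately have "tail_bound M / 2 \<le> measure (spherical_gaussian m (\<gamma> t) \<sigma>) (voronoi_cell m k \<gamma> t)"
    by simp
  also have "\<dots> \<le> (\<Sum>u\<in>{1..k}. measure (spherical_gaussian m (\<gamma> u) \<sigma>) (voronoi_cell m k \<gamma> t))"
    using t by (intro member_le_sum) auto
  finally have "tail_bound M / 2 / real k \<le>
      (\<Sum>u\<in>{1..k}. measure (spherical_gaussian m (\<gamma> u) \<sigma>) (voronoi_cell m k \<gamma> t)) / real k"
    by (rule divide_right_mono) simp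
  then show ?thesis
    by (simp add: measure_gaussian_mixture \<sigma>_pos k_pos sets_voronoi_cell cell_bound_def M_def)
qed

text \<open>The set lies in a cube in the first \<open>d\<close> coordinates, and each component is
  bounded separately. The first alternative uses coordinate \<open>j\<close> alone; the second
  multiplies \<open>d = k / 2\<close> factors \<open>1 - tail_bound r\<close>, each at most
  \<open>exp (- tail_bound r)\<close>.\<close>

lemma measure_voronoi_cell_near_le:
  assumes "0 \<le> r" "r \<le> q \<or> exp (- (real k / 2) * tail_bound r) \<le> q"
  shows "measure (gaussian_mixture m k \<gamma> \<sigma>) {x \<in> voronoi_cell m k \<gamma> t. s * x j < r * \<sigma>} \<le> q"
proof -
  define A where "A i = (if i < d then {-r*\<sigma><..<r*\<sigma>} else UNIV)" for i
  have sets: "PiE {..<m} A \<in> sets (\<Pi>\<^sub>M i\<in>{..<m}. lborel)"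
    by (intro sets_PiM_I_finite) (auto simp: A_def)
  have "{x \<in> voronoi_cell m k \<gamma> t. s * x j < r * \<sigma>} \<subseteq> PiE {..<m} A"
  proof
    fix x assume x: "x \<in> {x \<in> voronoi_cell m k \<gamma> t. s * x j < r * \<sigma>}"
    then have "\<bar>x i\<bar> < r * \<sigma>" if "i < d" for i
      using abs_le_of_mem_voronoi_cell[of x i] that by simp
    moreover have "x \<in> {..<m} \<rightarrow>\<^sub>E UNIV" using x by (simp add: voronoi_cell_def)
    ultimately show "x \<in> PiE {..<m} A"
      by (auto simp: PiE_iff A_def abs_less_iff minus_less_iff)
  qed
  then have "measure (gaussian_mixture m k \<gamma> \<sigma>) {x \<in> voronoi_cell m k \<gamma> t. s * x j < r * \<sigma>}
      \<le> measure (gaussian_mixture m k \<gamma> \<sigma>) (PiE {..<m} A)"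
    by (rule D.finite_measure_mono) (simp add: sets_gaussian_mixture[OF \<sigma>_pos] sets)
  also have "\<dots> = (\<Sum>u\<in>{1..k}. measure (spherical_gaussian m (\<gamma> u) \<sigma>) (PiE {..<m} A)) / real k"
    by (rule measure_gaussian_mixture[OF \<sigma>_pos k_pos sets])
  also have "\<dots> \<le> (\<Sum>u\<in>{1..k}. q) / real k"
  proof (intro divide_right_mono sum_mono)
    fix u
    have "measure (spherical_gaussian m (\<gamma> u) \<sigma>) (PiE {..<m} A)
        = (\<Prod>i<m. measure (gauss (\<gamma> u i) \<sigma>) (A i))"
      by (intro measure_spherical_gaussian_PiE \<sigma>_pos) (simp add: A_def)
    also have "\<dots> = (\<Prod>i<d. measure (gauss (\<gamma> u i) \<sigma>) (A i))"
      using d_le prob_space.prob_space[OF prob_space_normal_density[OF \<sigma>_pos]]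
      by (intro prod.mono_neutral_right) (auto simp: A_def)
    also have "\<dots> = (\<Prod>i<d. measure (gauss (\<gamma> u i) \<sigma>) {-r*\<sigma><..<r*\<sigma>})"
      by (simp add: A_def)
    finally have eq: "measure (spherical_gaussian m (\<gamma> u) \<sigma>) (PiE {..<m} A)
      = (\<Prod>i<d. measure (gauss (\<gamma> u i) \<sigma>) {-r*\<sigma><..<r*\<sigma>})" .
    from assms(2) show "measure (spherical_gaussian m (\<gamma> u) \<sigma>) (PiE {..<m} A) \<le> q"
    proof
      assume "r \<le> q"
      have "(\<Prod>i<d. measure (gauss (\<gamma> u i) \<sigma>) {-r*\<sigma><..<r*\<sigma>})
        = measure (gauss (\<gamma> u j) \<sigma>) {-r*\<sigma><..<r*\<sigma>} *
          (\<Prod>i\<in>{..<d} - {j}. measure (gauss (\<gamma> u i) \<sigma>) {-r*\<sigma><..<r*\<sigma>})"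
        using j by (subst prod.remove[of _ j]) auto
      also have "\<dots> \<le> r * 1"
        using assms(1) prob_space.prob_le_1[OF prob_space_normal_density[OF \<sigma>_pos]]
          measure_gauss_small_ball_le[OF \<sigma>_pos assms(1)]
        by (intro mult_mono prod_le_1) (auto intro: prod_nonneg)
      finally show ?thesis using eq \<open>r \<le> q\<close> by simp
    next
      assume le: "exp (- (real k / 2) * tail_bound r) \<le> q"
      have "measure (gauss (\<gamma> u i) \<sigma>) {-r*\<sigma><..<r*\<sigma>} \<le> exp (- tail_bound r)" for i
        using measure_gauss_concentration_le[OF \<sigma>_pos assms(1), of "\<gamma> u i"]
          exp_ge_add_one_self[of "- tail_bound r"] by linarith
      then have "(\<Prod>i<d. measure (gauss (\<gamma> u i) \<sigma>) {-r*\<sigma><..<r*\<sigma>}) \<le> (\<Prod>i<d. exp (- tail_bound r))"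
        by (intro prod_mono) auto
      also have "\<dots> = exp (- (real k / 2) * tail_bound r)"
        by (simp add: k_eq flip: exp_of_nat_mult)
      finally show ?thesis using eq le by simp
    qed
  qed simp
  finally show ?thesis using k_pos by simp
qed

text \<open>A Markov-type argument: \<open>s * x j\<close> is nonnegative on the whole cell and at
  least \<open>r * \<sigma>\<close> off \<open>?N\<close>, which carries at most half of the mass of
  the cell.\<close>

lemma voronoi_mean_component_ge:
  assumes "0 \<le> r" "r \<le> cell_bound k / 2 \<or> exp (- (real k / 2) * tail_bound r) \<le> cell_bound k / 2"
  shows "r * \<sigma> / 2 \<le> s * voronoi_mean m k \<gamma> (gaussian_mixture m k \<gamma> \<sigma>) t j"
proof -
  let ?D = "gaussian_mixture m k \<gamma> \<sigma>" and ?V = "voronoi_cell m k \<gamma> t"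
  let ?N = "{x \<in> ?V. s * x j < r * \<sigma>}"
  have V: "?V \<in> sets ?D" by (simp add: sets_gaussian_mixture[OF \<sigma>_pos] sets_voronoi_cell)
  have int: "integrable ?D (\<lambda>x. x j)"
    by (rule integrable_component_gaussian_mixture[OF \<sigma>_pos k_pos j_less_m])
  have N: "?N \<in> sets ?D"
  proof -
    have [measurable]: "(\<lambda>x. x j) \<in> borel_measurable ?D" using int by auto
    have "?N = ?V \<inter> {x \<in> space ?D. s * x j < r * \<sigma>}" using sets.sets_into_space[OF V] by auto
    then show ?thesis using V by simp
  qed
  have pos: "0 < D.prob ?V"
    using cell_bound_pos[OF k_pos] cell_bound_le_measure_voronoi_cell by linarith
  have "D.prob ?N \<le> D.prob ?V / 2"
    using measure_voronoi_cell_near_le[OF assms] cell_bound_le_measure_voronoi_cell by linarith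
  then have "D.prob ?V / 2 \<le> D.prob (?V - ?N)"
    using D.finite_measure_Diff[OF V N] by auto
  then have "r * \<sigma> * (D.prob ?V / 2) \<le> r * \<sigma> * D.prob (?V - ?N)"
    using assms(1) \<sigma>_pos by (intro mult_left_mono) auto
  also have "\<dots> = (\<integral>x. r * \<sigma> * indicator (?V - ?N) x \<partial>?D)"
    using V N by simp
  also have "\<dots> \<le> (\<integral>x. s * (indicator ?V x * x j) \<partial>?D)"
  proof (rule integral_mono)
    show "integrable ?D (\<lambda>x. r * \<sigma> * indicator (?V - ?N) x)"
      using V N by (intro integrable_mult_right integrable_real_indicator) (auto simp: less_top[symmetric])
    show "integrable ?D (\<lambda>x. s * (indicator ?V x * x j))"
      using integrable_mult_indicator[OF V int] by simp
    show "r * \<sigma> * indicator (?V - ?N) x \<le> s * (indicator ?V x * x j)" for x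
      using abs_le_of_mem_voronoi_cell[of x j] j by (auto split: split_indicator)
  qed
  also have "\<dots> = s * (LINT x:?V|?D. x j)" by (simp add: set_lebesgue_integral_def)
  finally show ?thesis
    using pos j_less_m by (simp add: voronoi_mean_def field_simps)
qed

end

end

section \<open>From the coordinate bound to the dichotomy with universal constants\<close>

theorem theorem7:
  "\<exists>C c :: real. C > 0 \<and> c > 0 \<and>
     (\<forall>(m::nat) (k::nat) (\<gamma> :: nat \<Rightarrow> nat \<Rightarrow> real) (\<sigma>::real).
        0 < k \<longrightarrow> even k \<longrightarrow> k \<le> 2 * m \<longrightarrow>
        bij_betw \<gamma> {1..k} (standard_orthoplex m (k div 2)) \<longrightarrow> \<sigma> > 0 \<longrightarrow>
          \<sigma> \<le> C * min_separation m k \<gamma> / sqrt (ln (real k)) \<or>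
          Min ((\<lambda>t. vdist m (voronoi_mean m k \<gamma> (gaussian_mixture m k \<gamma> \<sigma>) t) (\<gamma> t)) ` {1..k})
            \<ge> c * \<sigma> * sqrt (ln (real k)))"
proof -
  obtain \<alpha> where \<alpha>: "\<alpha> > 0" and threshold: "\<And>k. k \<ge> 2 \<Longrightarrow>
      \<alpha> * sqrt (ln (real k)) \<le> cell_bound k / 2 \<or>
      exp (- (real k / 2) * tail_bound (\<alpha> * sqrt (ln (real k)))) \<le> cell_bound k / 2"
    using exists_threshold_factor by blast
  show ?thesis
  \<comment> \<open>The mean reaches \<open>\<alpha> * ?L * \<sigma> / 2\<close> in direction
    \<open>s\<close> on axis \<open>j\<close>, and the centre sits at 1. If the first alternative
    with \<open>4 / \<alpha>\<close> fails, then 1 is at most half of this value, which leaves the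
    factor \<open>\<alpha> / 4\<close>.\<close>
  proof (rule exI[of _ "4 / \<alpha>"], rule exI[of _ "\<alpha> / 4"], intro conjI allI impI)
    fix m k :: nat and \<gamma> :: "nat \<Rightarrow> nat \<Rightarrow> real" and \<sigma> :: real
    assume k: "0 < k" "even k" "k \<le> 2 * m"
      and bij: "bij_betw \<gamma> {1..k} (standard_orthoplex m (k div 2))" and \<sigma>: "\<sigma> > 0"
    interpret orthoplex_mixture m "k div 2" k \<gamma> \<sigma>
      by unfold_locales (use k bij \<sigma> in auto)
    let ?L = "sqrt (ln (real k))"
    have k2: "2 \<le> k" using k by presburger
    then have L: "0 < ?L" by simp
    show "\<sigma> \<le> 4 / \<alpha> * min_separation m k \<gamma> / ?L \<or>
      Min ((\<lambda>t. vdist m (voronoi_mean m k \<gamma> (gaussian_mixture m k \<gamma> \<sigma>) t) (\<gamma> t)) ` {1..k}) \<ge> \<alpha> / 4 * \<sigma> * ?L"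
    proof (intro disj_imp[THEN iffD2] impI)
      assume "\<not> \<sigma> \<le> 4 / \<alpha> * min_separation m k \<gamma> / ?L"
      then have "4 * min_separation m k \<gamma> < \<alpha> * ?L * \<sigma>"
        using \<alpha> L by (simp add: field_simps)
      then have large: "1 \<le> \<alpha> * ?L * \<sigma> / 4" using min_separation_ge_one by linarith
      have "\<alpha> / 4 * \<sigma> * ?L \<le> vdist m (voronoi_mean m k \<gamma> (gaussian_mixture m k \<gamma> \<sigma>) t) (\<gamma> t)"
        if t: "t \<in> {1..k}" for t
      proof -
        let ?\<mu> = "voronoi_mean m k \<gamma> (gaussian_mixture m k \<gamma> \<sigma>) t"
        obtain j s where j: "j < k div 2" "s \<in> {1, -1}" "\<gamma> t = signed_basis m j s"
          using center_cases[OF t] .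
        then have jm: "j < m" using d_le by simp
        have "\<alpha> * ?L * \<sigma> / 2 \<le> s * ?\<mu> j"
          using \<alpha> L threshold[OF k2] by (intro voronoi_mean_component_ge[OF t j]) auto
        \<comment> \<open>As \<open>s\<close> squared is 1, the left side equals
          \<open>s * (?\<mu> j - s)\<close>, and \<gamma> \<open>t j\<close> is
          \<open>s\<close>.\<close>
        moreover have "s * ?\<mu> j - 1 \<le> \<bar>?\<mu> j - \<gamma> t j\<bar>"
          using j jm by (auto simp: signed_basis_def)
        moreover have "\<dots> \<le> vdist m ?\<mu> (\<gamma> t)" using jm by (rule abs_component_le_vdist)
        ultimately show ?thesis using large by (simp add: mult_ac)
      qed
      then show "Min ((\<lambda>t. vdist m (voronoi_mean m k \<gamma> (gaussian_mixture m k \<gamma> \<sigma>) t) (\<gamma> t)) ` {1..k})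
          \<ge> \<alpha> / 4 * \<sigma> * ?L"
        using k by (subst Min_ge_iff) auto
    qed
  qed (use \<alpha> in auto)
qed

end
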